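(* Let $\mathcal H$ be a real Hilbert space, $h>0$, $\gamma\ge0$, $\beta\ge0$. Let $f\in C^1(\mathcal H)$ be real-valued with $\inf_{\mathcal H}f>-\infty$ and $\nabla f$ globally $L$-Lipschitz continuous, $L\ge0$. Let $\phi:\mathcal H\to\mathbb R\cup\{+\infty\}$ be proper, lower semicontinuous and convex with $\phi(0)=\min\phi=0$ and $r\mathbb B\subseteq\partial\phi(0)$ for some $r>0$. Let $x_0,v_0\in\mathcal H$ and let $(x_k,v_k)_{k\ge0}$ be generated by $$\frac{v_{k+1}-v_k}{h}+\gamma v_{k+1}+\partial\phi(v_{k+1})+\nabla f(x_k+\beta v_k)\ni0,\qquad \frac{x_{k+1}-x_k}{h}=v_{k+1}\qquad(k\ge0).$$ Set $y_k=x_k+\beta v_k$, $$\rho_k=\sup\left(\{0\}\cup\{\rho>0:\ -\nabla f(y_k)+\rho\mathbb B\subseteq\partial\phi(0)\}\right),$$ and $K_{\mathrm{stop}}=\inf\{K\in\mathbb N:\ v_k=0\text{ for every }k\ge K\}$ (with $\inf\varnothing=+\infty$). (a) If $\rho_k>0$ and $v_{k+1}\ne0$, then $(1+h\gamma)\|v_{k+1}\|+h\rho_k\le\|v_k\|$. (b) Suppose that $\rho_k\ge\varepsilon>0$ for every $k\ge k_0$. If $\gamma>0$, then $$K_{\mathrm{stop}}-k_0\le\left\lceil\frac{\log(1+\gamma\|v_{k_0}\|/\varepsilon)}{\log(1+h\gamma)}\right\rceil .$$ If $\gamma=0$, then $K_{\mathrm{stop}}-k_0\le\left\lceil\frac{\|v_{k_0}\|}{h\varepsilon}\right\rceil$.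 (c) Suppose $\gamma>0$, $v_0\in\mathrm{dom}(\phi)$, and that the matrix $$M_h=\begin{pmatrix}h\gamma-\frac{Lh^2}{2}&-\frac{Lh\beta}{2}\\-\frac{Lh\beta}{2}&\frac12+\frac{\beta}{h}+\frac{\beta\gamma}{2}-\frac{L\beta^2}{2}\end{pmatrix}$$ is positive semidefinite, so that $x_k$ converges strongly to some $x_\infty\in\mathcal H$. If $-\nabla f(x_\infty)\in\mathrm{int}(\partial\phi(0))$, then $K_{\mathrm{stop}}<+\infty$.
   Context: $\mathbb B$ is the closed unit ball, $\partial\phi$ the convex subdifferential, $\mathrm{dom}(\phi)=\{v:\phi(v)<+\infty\}$, $\mathbb N=\{0,1,2,\dots\}$. The recursion has a unique solution: $v_{k+1}=\mathrm{prox}_{\lambda_h\phi}\bigl(\frac{1}{1+h\gamma}v_k-\lambda_h\nabla f(x_k+\beta v_k)\bigr)$ with $\lambda_h=\frac{h}{1+h\gamma}$. *)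

theory Defs
  imports "HOL-Analysis.Analysis"
begin

text \<open>Functions into \<open>(-\<infinity>, +\<infinity>]\<close> are encoded as \<^typ>\<open>ereal\<close>-valued functions; that the value
  \<open>-\<infinity>\<close> is not taken is part of \<open>proper_fun\<close>.\<close>

definition eff_dom :: "('a \<Rightarrow> ereal) \<Rightarrow> 'a set" where
  "eff_dom \<phi> = {v. \<phi> v < \<infinity>}"

definition proper_fun :: "('a \<Rightarrow> ereal) \<Rightarrow> bool" where
  "proper_fun \<phi> \<longleftrightarrow> (\<forall>v. \<phi> v \<noteq> -\<infinity>) \<and> eff_dom \<phi> \<noteq> {}"

text \<open>\<^term>\<open>at x\<close> excludes \<open>x\<close> itself, which does not affect the condition.\<close>

definition lsc_fun :: "('a::topological_space \<Rightarrow> ereal) \<Rightarrow> bool" where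
  "lsc_fun \<phi> \<longleftrightarrow> (\<forall>x. \<phi> x \<le> Liminf (at x) \<phi>)"

definition convex_fun :: "('a::real_vector \<Rightarrow> ereal) \<Rightarrow> bool" where
  "convex_fun \<phi> \<longleftrightarrow>
     (\<forall>u w. \<forall>t\<in>{0<..<1::real}.
        \<phi> ((1 - t) *\<^sub>R u + t *\<^sub>R w) \<le> ereal (1 - t) * \<phi> u + ereal t * \<phi> w)"

definition subdifferential :: "('a::real_inner \<Rightarrow> ereal) \<Rightarrow> 'a \<Rightarrow> 'a set" where
  "subdifferential \<phi> v =
     {\<xi>. v \<in> eff_dom \<phi> \<and> (\<forall>w. \<phi> w \<ge> \<phi> v + ereal (inner \<xi> (w - v)))}"

text \<open>The set on the right is the Minkowski sum of the point
  \<open>(v\<^bsub>k+1\<^esub> - v\<^bsub>k\<^esub>)/h + \<gamma> v\<^bsub>k+1\<^esub> + \<nabla>f(x\<^bsub>k\<^esub> + \<beta> v\<^bsub>k\<^esub>)\<close> and \<open>\<partial>\<phi>(v\<^bsub>k+1\<^esub>)\<close>;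
  \<open>gf\<close> plays the role of \<open>\<nabla>f\<close>.\<close>

definition generated_by ::
  "real \<Rightarrow> real \<Rightarrow> real \<Rightarrow> ('a::real_inner \<Rightarrow> 'a) \<Rightarrow> ('a \<Rightarrow> ereal) \<Rightarrow> (nat \<Rightarrow> 'a) \<Rightarrow> (nat \<Rightarrow> 'a) \<Rightarrow> bool"
where
  "generated_by h \<gamma> \<beta> gf \<phi> x v \<longleftrightarrow>
     (\<forall>k. 0 \<in> (\<lambda>\<xi>. (v (Suc k) - v k) /\<^sub>R h + \<gamma> *\<^sub>R v (Suc k) + \<xi> + gf (x k + \<beta> *\<^sub>R v k))
                 ` subdifferential \<phi> (v (Suc k))
        \<and> (x (Suc k) - x k) /\<^sub>R h = v (Suc k))"

text \<open>With \<open>g = \<nabla>f(y\<^bsub>k\<^esub>)\<close> this is \<open>\<rho>\<^bsub>k\<^esub>\<close>.  It is \<open>+\<infinity>\<close> when \<open>\<partial>\<phi>(0)\<close> is the whole space,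
  hence the type \<^typ>\<open>ereal\<close>.\<close>

definition stick_margin :: "('a::real_inner \<Rightarrow> ereal) \<Rightarrow> 'a \<Rightarrow> ereal" where
  "stick_margin \<phi> g =
     Sup ({0} \<union> {ereal \<rho> |\<rho>. \<rho> > 0 \<and> cball (- g) \<rho> \<subseteq> subdifferential \<phi> 0})"

definition K_stop :: "(nat \<Rightarrow> 'a::zero) \<Rightarrow> enat" where
  "K_stop v = Inf {enat K |K. \<forall>k\<ge>K. v k = 0}"

definition pos_semidef :: "real^'n^'n \<Rightarrow> bool" where
  "pos_semidef A \<longleftrightarrow> transpose A = A \<and> (\<forall>z. 0 \<le> inner z (A *v z))"

definition M_mat :: "real \<Rightarrow> real \<Rightarrow> real \<Rightarrow> real \<Rightarrow> real^2^2" where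
  "M_mat h \<gamma> \<beta> L = vector
     [vector [h * \<gamma> - L * h\<^sup>2 / 2,   - (L * h * \<beta> / 2)],
      vector [- (L * h * \<beta> / 2),      1 / 2 + \<beta> / h + \<beta> * \<gamma> / 2 - L * \<beta>\<^sup>2 / 2]]"

end

theory Submission
  imports Defs
begin

text \<open>Testing the inclusion against \<open>v\<^bsub>k+1\<^esub>\<close> and using \<open>\<phi>(w) \<ge> -\<langle>\<nabla>f(y\<^bsub>k\<^esub>), w\<rangle> + \<rho>\<parallel>w\<parallel>\<close>, which is
  what \<open>-\<nabla>f(y\<^bsub>k\<^esub>) + \<rho>\<bool> \<subseteq> \<partial>\<phi>(0)\<close> says, gives (a).  Thus \<open>0\<close> is absorbing while the margin stays
  positive, and iterating (a) gives \<open>h\<epsilon> \<Sum>\<^bsub>i<N\<^esub> (1 + h\<gamma>)\<^sup>i < \<parallel>v\<^bsub>k\<^sub>0\<^esub>\<parallel>\<close> as long as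
  \<open>v\<^bsub>k\<^sub>0+N\<^esub> \<noteq> 0\<close>, which is (b).  For (c), the energy
  \<open>f(y\<^bsub>k\<^esub>) + (1 + \<beta>\<gamma>)/2 \<parallel>v\<^bsub>k\<^esub>\<parallel>\<^sup>2 + \<beta>\<phi>(v\<^bsub>k\<^esub>)\<close> decreases by at least \<open>h\<phi>(v\<^bsub>k+1\<^esub>) \<ge> hr\<parallel>v\<^bsub>k+1\<^esub>\<parallel>\<close> plus the
  quadratic form of \<open>M\<^sub>h\<close> at \<open>(v\<^bsub>k+1\<^esub>, v\<^bsub>k+1\<^esub> - v\<^bsub>k\<^esub>)\<close>.  Hence \<open>\<Sum>\<parallel>v\<^bsub>k\<^esub>\<parallel> < \<infinity>\<close>, so \<open>x\<^bsub>k\<^esub>\<close> converges,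
  \<open>y\<^bsub>k\<^esub>\<close> has the same limit, and the margin is eventually bounded away from \<open>0\<close>.\<close>

section \<open>Descent inequality and subgradient estimates\<close>

text \<open>Along the segment from \<open>z\<close> to \<open>z + d\<close>, the auxiliary
  \<open>F\<close> subtracts the linear and quadratic terms from \<open>f\<close>. Cauchy-Schwarz
  and the Lipschitz bound make \<open>F'\<close> nonpositive for \<open>t \<ge> 0\<close>, and
  \<open>F 1 \<le> F 0\<close> is the claim.\<close>

lemma lipschitz_gradient_upper_bound:
  fixes f :: "'a::real_inner \<Rightarrow> real"
  assumes der: "\<And>z. GDERIV f z :> gf z"
    and lip: "L-lipschitz_on UNIV gf"
  shows "f (z + d) \<le> f z + inner (gf z) d + L / 2 * (norm d)\<^sup>2"
proof -
  define F where "F t = f (z + t *\<^sub>R d) - t * inner (gf z) d - L / 2 * t\<^sup>2 * (norm d)\<^sup>2" for t :: real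
  define F' where "F' t = inner (gf (z + t *\<^sub>R d)) d - inner (gf z) d - L * t * (norm d)\<^sup>2" for t :: real
  have "(F has_real_derivative F' t) (at t)" for t
  proof -
    have "((\<lambda>t. z + t *\<^sub>R d) has_derivative (\<lambda>s. s *\<^sub>R d)) (at t)"
      by (auto intro!: derivative_eq_intros)
    moreover have "(f has_derivative (\<lambda>u. inner u (gf (z + t *\<^sub>R d)))) (at (z + t *\<^sub>R d))"
      using der by (simp add: gderiv_def)
    ultimately have "((\<lambda>t. f (z + t *\<^sub>R d)) has_derivative
        (\<lambda>s. inner (s *\<^sub>R d) (gf (z + t *\<^sub>R d)))) (at t)"
      by (rule has_derivative_compose)
    moreover have "(\<lambda>s. inner (s *\<^sub>R d) (gf (z + t *\<^sub>R d))) = (*) (inner (gf (z + t *\<^sub>R d)) d)"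
      by (auto simp: inner_commute)
    ultimately have "((\<lambda>t. f (z + t *\<^sub>R d)) has_real_derivative inner (gf (z + t *\<^sub>R d)) d) (at t)"
      by (simp only: has_field_derivative_def)
    then show ?thesis
      unfolding F_def F'_def by (auto intro!: derivative_eq_intros)
  qed
  moreover have "F' t \<le> 0" if "0 \<le> t" for t
  proof -
    have "inner (gf (z + t *\<^sub>R d) - gf z) d \<le> norm (gf (z + t *\<^sub>R d) - gf z) * norm d"
      by (rule norm_cauchy_schwarz)
    also have "norm (gf (z + t *\<^sub>R d) - gf z) \<le> L * (t * norm d)"
      using lipschitz_onD[OF lip, of "z + t *\<^sub>R d" z] that by (simp add: dist_norm)
    finally show ?thesis
      unfolding F'_def by (simp add: inner_diff_left power2_eq_square mult_right_mono algebra_simps)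
  qed
  ultimately have "F 1 \<le> F 0"
    by (intro DERIV_nonpos_imp_nonincreasing[of 0 1 F]) auto
  then show ?thesis by (simp add: F_def)
qed

text \<open>Among the slopes in the ball, \<open>c + \<rho> *\<^sub>R sgn w\<close> gives the
  largest linear minorant at \<open>w\<close>. Since \<open>sgn 0 = 0\<close>, this slope also
  serves \<open>w = 0\<close>.\<close>

lemma subdifferential_at_0_cball_lower_bound:
  fixes \<phi> :: "'a::real_inner \<Rightarrow> ereal"
  assumes zero: "\<phi> 0 = 0" and "0 \<le> \<rho>" and sub: "cball c \<rho> \<subseteq> subdifferential \<phi> 0"
  shows "ereal (inner c w + \<rho> * norm w) \<le> \<phi> w"
proof -
  have "c + \<rho> *\<^sub>R sgn w \<in> cball c \<rho>"
    using \<open>0 \<le> \<rho>\<close> by (simp add: dist_norm norm_sgn)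
  with sub have "\<phi> 0 + ereal (inner (c + \<rho> *\<^sub>R sgn w) (w - 0)) \<le> \<phi> w"
    unfolding subdifferential_def by blast
  moreover have "inner (sgn w) w = norm w"
    by (cases "w = 0") (simp_all add: sgn_div_norm power2_norm_eq_inner[symmetric] power2_eq_square)
  ultimately show ?thesis by (simp add: zero inner_add_left)
qed

lemma generated_by_subgradient:
  assumes "h > 0" and "generated_by h \<gamma> \<beta> gf \<phi> x v"
  obtains \<xi> where "\<xi> \<in> subdifferential \<phi> (v (Suc k))"
    and "v k = (1 + h * \<gamma>) *\<^sub>R v (Suc k) + h *\<^sub>R \<xi> + h *\<^sub>R gf (x k + \<beta> *\<^sub>R v k)"
proof -
  obtain \<xi> where \<xi>: "\<xi> \<in> subdifferential \<phi> (v (Suc k))"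
    and "0 = (v (Suc k) - v k) /\<^sub>R h + \<gamma> *\<^sub>R v (Suc k) + \<xi> + gf (x k + \<beta> *\<^sub>R v k)"
    using assms(2) unfolding generated_by_def by (meson imageE)
  then have "h *\<^sub>R 0 = h *\<^sub>R ((v (Suc k) - v k) /\<^sub>R h + \<gamma> *\<^sub>R v (Suc k) + \<xi> + gf (x k + \<beta> *\<^sub>R v k))"
    by (simp only:)
  with \<open>h > 0\<close> have "v k = (1 + h * \<gamma>) *\<^sub>R v (Suc k) + h *\<^sub>R \<xi> + h *\<^sub>R gf (x k + \<beta> *\<^sub>R v k)"
    by (simp add: algebra_simps)
  with \<xi> show ?thesis by (rule that)
qed

text \<open>Both values of \<open>\<phi>\<close> are finite here, so \<open>real_of_ereal\<close>
  loses nothing. Taking \<open>w = 0\<close> bounds \<open>inner \<xi> u\<close> below by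
  \<open>\<phi> u\<close>; taking \<open>w = v k\<close> yields the increment of
  \<open>\<phi>\<close> in the energy estimate.\<close>

lemma subdifferential_inner_ge:
  fixes \<phi> :: "'a::real_inner \<Rightarrow> ereal"
  assumes nonneg: "\<And>z. 0 \<le> \<phi> z" and \<xi>: "\<xi> \<in> subdifferential \<phi> u" and w: "w \<in> eff_dom \<phi>"
  shows "real_of_ereal (\<phi> u) - real_of_ereal (\<phi> w) \<le> inner \<xi> (u - w)"
proof -
  have "u \<in> eff_dom \<phi>" and *: "\<phi> u + ereal (inner \<xi> (w - u)) \<le> \<phi> w"
    using \<xi> by (auto simp: subdifferential_def)
  then obtain a b where "\<phi> u = ereal a" "\<phi> w = ereal b"
    using nonneg[of u] nonneg[of w] w unfolding eff_dom_def
    by (cases "\<phi> u"; cases "\<phi> w") auto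
  with * show ?thesis by (simp add: inner_diff_right)
qed

section \<open>Loss of speed in one step\<close>

lemma stick_step:
  assumes "h > 0" and zero: "\<phi> 0 = 0" and nonneg: "\<And>z. 0 \<le> \<phi> z"
    and gen: "generated_by h \<gamma> \<beta> gf \<phi> x v"
    and "0 \<le> \<rho>" and sub: "cball (- gf (x k + \<beta> *\<^sub>R v k)) \<rho> \<subseteq> subdifferential \<phi> 0"
    and "v (Suc k) \<noteq> 0"
  shows "(1 + h * \<gamma>) * norm (v (Suc k)) + h * \<rho> \<le> norm (v k)"
proof -
  define w g where "w = v (Suc k)" and "g = gf (x k + \<beta> *\<^sub>R v k)"
  obtain \<xi> where \<xi>: "\<xi> \<in> subdifferential \<phi> w" and vk: "v k = (1 + h * \<gamma>) *\<^sub>R w + h *\<^sub>R \<xi> + h *\<^sub>R g"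
    using generated_by_subgradient[OF \<open>h > 0\<close> gen] unfolding w_def g_def by metis
  have w: "w \<in> eff_dom \<phi>" using \<xi> by (simp add: subdifferential_def)
  have "ereal (inner (- g) w + \<rho> * norm w) \<le> \<phi> w"
    unfolding g_def using zero \<open>0 \<le> \<rho>\<close> sub by (rule subdifferential_at_0_cball_lower_bound)
  then have "inner (- g) w + \<rho> * norm w \<le> real_of_ereal (\<phi> w)"
    using w by (cases "\<phi> w") (auto simp: eff_dom_def)
  also have "\<dots> \<le> inner \<xi> w"
    using subdifferential_inner_ge[OF nonneg \<xi>, of 0] zero by (simp add: eff_dom_def)
  finally have "h * (\<rho> * norm w) \<le> h * (inner \<xi> w + inner g w)"
    using \<open>h > 0\<close> by simp
  \<comment> \<open>Pairing \<open>v k\<close> with \<open>w\<close> turns the friction and gradient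
    terms into at least \<open>h * \<rho> * norm w\<close>. Every term then carries a factor
    \<open>norm w\<close>, which is cancelled at the end.\<close>
  then have "((1 + h * \<gamma>) * norm w + h * \<rho>) * norm w \<le> inner (v k) w"
    unfolding vk by (simp add: inner_add_left power2_norm_eq_inner[symmetric] power2_eq_square algebra_simps)
  also have "\<dots> \<le> norm (v k) * norm w" by (rule norm_cauchy_schwarz)
  finally show ?thesis
    using \<open>v (Suc k) \<noteq> 0\<close> by (simp add: w_def)
qed

text \<open>Every admissible radius obeys the same bound \<open>?b\<close> by
  \<open>stick_step\<close>, hence so does their supremum, whether or not it is attained. In
  particular the margin is finite whenever the next velocity is nonzero.\<close>

lemma stick_margin_step:
  assumes "h > 0" and "\<phi> 0 = 0" and "\<And>z. 0 \<le> \<phi> z"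
    and "generated_by h \<gamma> \<beta> gf \<phi> x v"
    and pos: "0 < stick_margin \<phi> (gf (x k + \<beta> *\<^sub>R v k))" and nz: "v (Suc k) \<noteq> 0"
  shows "ereal ((1 + h * \<gamma>) * norm (v (Suc k))) + ereal h * stick_margin \<phi> (gf (x k + \<beta> *\<^sub>R v k))
    \<le> ereal (norm (v k))"
proof -
  let ?m = "stick_margin \<phi> (gf (x k + \<beta> *\<^sub>R v k))"
  let ?b = "(norm (v k) - (1 + h * \<gamma>) * norm (v (Suc k))) / h"
  have le: "\<rho> \<le> ?b" if "\<rho> > 0" "cball (- gf (x k + \<beta> *\<^sub>R v k)) \<rho> \<subseteq> subdifferential \<phi> 0" for \<rho>
    using stick_step[of h \<phi> \<gamma> \<beta> gf x v \<rho> k] that assms by (simp add: field_simps)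
  \<comment> \<open>The supremum also ranges over \<open>0\<close>, so \<open>0 \<le> ?b\<close> is
    required; a positive margin supplies an admissible radius below \<open>?b\<close>.\<close>
  obtain \<rho> where "\<rho> > 0" "cball (- gf (x k + \<beta> *\<^sub>R v k)) \<rho> \<subseteq> subdifferential \<phi> 0"
    using pos unfolding stick_margin_def less_Sup_iff by auto
  then have "0 \<le> ?b" using le by fastforce
  then have "?m \<le> ereal ?b"
    unfolding stick_margin_def by (intro Sup_least) (auto intro: le)
  then obtain m where m: "?m = ereal m" "m \<le> ?b"
    using pos by (cases ?m) auto
  from m(2) \<open>h > 0\<close> have "(1 + h * \<gamma>) * norm (v (Suc k)) + h * m \<le> norm (v k)"
    by (simp add: field_simps)
  then show ?thesis by (simp add: m(1))
qed

section \<open>Counting the steps until rest\<close>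

lemma K_stop_le:
  assumes "v K = 0" and "\<And>k. k \<ge> K \<Longrightarrow> v k = 0 \<Longrightarrow> v (Suc k) = 0"
  shows "K_stop v \<le> enat K"
proof -
  have "v k = 0" if "k \<ge> K" for k
    using that assms by (induction k rule: dec_induct) auto
  then show ?thesis unfolding K_stop_def by (intro Inf_lower) auto
qed

text \<open>This unrolls \<open>step\<close>, which is available only at nonzero velocities. Since
  \<open>0\<close> is absorbing, a nonzero velocity at \<open>k0 + n\<close> forces all velocities
  from \<open>k0\<close> up to it to be nonzero.\<close>

lemma norm_geometric_decay:
  fixes v :: "nat \<Rightarrow> 'a::real_normed_vector" and q c :: real
  assumes "q \<ge> 0"
    and absorb: "\<And>k. k \<ge> k0 \<Longrightarrow> v k = 0 \<Longrightarrow> v (Suc k) = 0"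
    and step: "\<And>k. k \<ge> k0 \<Longrightarrow> v (Suc k) \<noteq> 0 \<Longrightarrow> q * norm (v (Suc k)) + c \<le> norm (v k)"
    and "v (k0 + n) \<noteq> 0"
  shows "q ^ n * norm (v (k0 + n)) + c * (\<Sum>i<n. q ^ i) \<le> norm (v k0)"
  using \<open>v (k0 + n) \<noteq> 0\<close>
proof (induction n)
  case (Suc n)
  have "q ^ n * (q * norm (v (Suc (k0 + n))) + c) \<le> q ^ n * norm (v (k0 + n))"
    using step[of "k0 + n"] Suc.prems \<open>q \<ge> 0\<close> by (intro mult_left_mono) auto
  moreover have "v (k0 + n) \<noteq> 0" using absorb[of "k0 + n"] Suc.prems by auto
  ultimately show ?case using Suc.IH by (simp add: algebra_simps)
qed simp

text \<open>The condition on \<open>N\<close> says that the weighted losses of \<open>N\<close>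
  steps exhaust the speed at \<open>k0\<close>. Keeping the geometric sum unevaluated lets both
  cases of (b) and the finiteness in (c) share this bound.\<close>

lemma K_stop_le_of_margin:
  assumes "h > 0" and "\<gamma> \<ge> 0" and "\<phi> 0 = 0" and "\<And>z. 0 \<le> \<phi> z"
    and "generated_by h \<gamma> \<beta> gf \<phi> x v"
    and "\<epsilon> > 0" and margin: "\<And>k. k \<ge> k0 \<Longrightarrow> ereal \<epsilon> \<le> stick_margin \<phi> (gf (x k + \<beta> *\<^sub>R v k))"
    and N: "norm (v k0) \<le> h * \<epsilon> * (\<Sum>i<N. (1 + h * \<gamma>) ^ i)"
  shows "K_stop v \<le> enat (k0 + N)"
proof -
  have hg: "h * \<gamma> \<ge> 0" using assms by simp
  have step: "(1 + h * \<gamma>) * norm (v (Suc k)) + h * \<epsilon> \<le> norm (v k)" if "k \<ge> k0" "v (Suc k) \<noteq> 0" for k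
  proof -
    let ?m = "stick_margin \<phi> (gf (x k + \<beta> *\<^sub>R v k))"
    have "0 < ereal \<epsilon>" using \<open>\<epsilon> > 0\<close> by simp
    also have "\<dots> \<le> ?m" using margin that by blast
    finally have "ereal ((1 + h * \<gamma>) * norm (v (Suc k))) + ereal h * ?m \<le> ereal (norm (v k))"
      using stick_margin_step assms that by blast
    moreover have "ereal h * ereal \<epsilon> \<le> ereal h * ?m"
      using margin[OF that(1)] \<open>h > 0\<close> by (intro ereal_mult_left_mono) auto
    ultimately have "ereal ((1 + h * \<gamma>) * norm (v (Suc k))) + ereal h * ereal \<epsilon> \<le> ereal (norm (v k))"
      by (meson add_left_mono order_trans)
    then show ?thesis by simp
  qed
  have absorb: "v (Suc k) = 0" if "k \<ge> k0" "v k = 0" for k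
  proof (rule ccontr)
    assume "v (Suc k) \<noteq> 0"
    moreover have "0 \<le> (1 + h * \<gamma>) * norm (v (Suc k))" "0 < h * \<epsilon>" using hg assms by auto
    ultimately show False using step[of k] that by simp
  qed
  have "v (k0 + N) = 0"
  proof (rule ccontr)
    \<comment> \<open>The decay estimate retains a strictly positive term in
      \<open>norm (v (k0 + N))\<close>, so equality in the condition on \<open>N\<close> is already
      contradictory. This is why no extra step is added to the ceilings.\<close>
    assume nz: "v (k0 + N) \<noteq> 0"
    have "(1 + h * \<gamma>) ^ N * norm (v (k0 + N)) + h * \<epsilon> * (\<Sum>i<N. (1 + h * \<gamma>) ^ i) \<le> norm (v k0)"
      using norm_geometric_decay[of "1 + h * \<gamma>" k0 v "h * \<epsilon>" N] hg absorb step nz by simp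
    with N have "(1 + h * \<gamma>) ^ N * norm (v (k0 + N)) \<le> 0" by linarith
    moreover have "0 < (1 + h * \<gamma>) ^ N * norm (v (k0 + N))" using nz hg by simp
    ultimately show False by simp
  qed
  then show ?thesis using absorb by (intro K_stop_le) auto
qed

text \<open>The least natural number above \<open>c\<close> is \<open>nat \<lceil>c\<rceil>\<close>,
  and \<open>0 \<le> c\<close> keeps \<open>nat\<close> from truncating. The difference is taken in
  \<open>ereal\<close>, so it may be negative if rest is reached before \<open>k0\<close>.\<close>

lemma K_stop_le_ceiling:
  fixes c :: real
  assumes "0 \<le> c" and "\<And>N. c \<le> real N \<Longrightarrow> K_stop v \<le> enat (k0 + N)"
  shows "ereal_of_enat (K_stop v) - ereal (real k0) \<le> ereal (of_int \<lceil>c\<rceil>)"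
proof -
  define N where "N = nat \<lceil>c\<rceil>"
  have ceil: "of_int \<lceil>c\<rceil> = real N" using \<open>0 \<le> c\<close> by (simp add: N_def)
  have "K_stop v \<le> enat (k0 + N)"
    by (rule assms(2)) (simp add: N_def real_nat_ceiling_ge)
  then show ?thesis unfolding ceil by (cases "K_stop v") (auto simp: ereal_of_enat_simps)
qed

section \<open>Energy dissipation and summable velocities\<close>

text \<open>Semidefiniteness on real pairs transfers to pairs of vectors through their norms:
  Cauchy-Schwarz bounds the mixed term by its worst case.\<close>

lemma M_mat_quadratic_form_nonneg:
  fixes w d :: "'a::real_inner"
  assumes "pos_semidef (M_mat h \<gamma> \<beta> L)"
  shows "0 \<le> (h * \<gamma> - L * h\<^sup>2 / 2) * (norm w)\<^sup>2 - L * h * \<beta> * inner w d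
    + (1 / 2 + \<beta> / h + \<beta> * \<gamma> / 2 - L * \<beta>\<^sup>2 / 2) * (norm d)\<^sup>2"
proof -
  have form: "0 \<le> (h * \<gamma> - L * h\<^sup>2 / 2) * s\<^sup>2 - L * h * \<beta> * (s * t)
    + (1 / 2 + \<beta> / h + \<beta> * \<gamma> / 2 - L * \<beta>\<^sup>2 / 2) * t\<^sup>2" for s t
  proof -
    have "0 \<le> inner (vector [s, t] :: real^2) (M_mat h \<gamma> \<beta> L *v vector [s, t])"
      using assms by (simp add: pos_semidef_def)
    then show ?thesis
      unfolding M_mat_def
      by (simp add: inner_vec_def matrix_vector_mult_def sum_2 power2_eq_square algebra_simps)
  qed
  have cs: "\<bar>L * h * \<beta> * inner w d\<bar> \<le> \<bar>L * h * \<beta>\<bar> * (norm w * norm d)"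
    unfolding abs_mult[of _ "inner w d"]
    by (intro mult_left_mono Cauchy_Schwarz_ineq2) auto
  show ?thesis
  \<comment> \<open>The sign of the second coordinate is chosen so that the scalar mixed term is
    \<open>- \<bar>L * h * \<beta>\<bar> * (norm w * norm d)\<close>.\<close>
  proof (cases "0 \<le> L * h * \<beta>")
    case True
    then show ?thesis using form[of "norm w" "norm d"] cs by linarith
  next
    case False
    then show ?thesis using form[of "norm w" "- norm d"] cs by simp
  qed
qed

text \<open>The weights come from testing the inclusion with
  \<open>h *\<^sub>R w + \<beta> *\<^sub>R d\<close>, the increment of \<open>y\<close>: the kinetic
  term absorbs \<open>(1 + \<beta> * \<gamma>) * inner w d\<close>, and
  \<open>\<beta> * \<phi>\<close> absorbs \<open>\<beta> * inner \<xi> d\<close>. It is applied only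
  where \<phi> is finite.\<close>

definition energy :: "('a::real_inner \<Rightarrow> real) \<Rightarrow> ('a \<Rightarrow> ereal) \<Rightarrow> real \<Rightarrow> real \<Rightarrow> 'a \<Rightarrow> 'a \<Rightarrow> real" where
  "energy f \<phi> \<beta> \<gamma> x v =
     f (x + \<beta> *\<^sub>R v) + (1 + \<beta> * \<gamma>) / 2 * (norm v)\<^sup>2 + \<beta> * real_of_ereal (\<phi> v)"

lemma energy_step:
  assumes "h > 0" and "\<beta> \<ge> 0"
    and der: "\<And>z. GDERIV f z :> gf z" and lip: "L-lipschitz_on UNIV gf"
    and zero: "\<phi> 0 = 0" and nonneg: "\<And>z. 0 \<le> \<phi> z"
    and gen: "generated_by h \<gamma> \<beta> gf \<phi> x v"
    and psd: "pos_semidef (M_mat h \<gamma> \<beta> L)" and dom: "v k \<in> eff_dom \<phi>"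
  shows "energy f \<phi> \<beta> \<gamma> (x (Suc k)) (v (Suc k)) + h * real_of_ereal (\<phi> (v (Suc k)))
    \<le> energy f \<phi> \<beta> \<gamma> (x k) (v k)"
proof -
  define w d g where "w = v (Suc k)" and "d = v (Suc k) - v k" and "g = gf (x k + \<beta> *\<^sub>R v k)"
  define pw pv where "pw = real_of_ereal (\<phi> w)" and "pv = real_of_ereal (\<phi> (v k))"
  obtain \<xi> where \<xi>: "\<xi> \<in> subdifferential \<phi> w" and vk: "v k = (1 + h * \<gamma>) *\<^sub>R w + h *\<^sub>R \<xi> + h *\<^sub>R g"
    using generated_by_subgradient[OF \<open>h > 0\<close> gen] unfolding w_def g_def by metis
  have v_eq: "v k = w - d" by (simp add: w_def d_def)
  have x_eq: "x (Suc k) = x k + h *\<^sub>R w"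
  proof -
    have "h *\<^sub>R ((x (Suc k) - x k) /\<^sub>R h) = h *\<^sub>R w"
      using gen by (simp only: generated_by_def w_def)
    then show ?thesis using \<open>h > 0\<close> by (simp add: algebra_simps)
  qed
  \<comment> \<open>The inclusion eliminates the gradient, so that the descent inequality involves
    only \<open>w\<close>, \<open>d\<close> and \<open>\<xi>\<close>.\<close>
  have hg: "h * inner g u = - inner d u - h * \<gamma> * inner w u - h * inner \<xi> u" for u
  proof -
    have "h *\<^sub>R g = - d - (h * \<gamma>) *\<^sub>R w - h *\<^sub>R \<xi>"
      using vk unfolding v_eq by (simp add: algebra_simps eq_neg_iff_add_eq_0)
    then have "inner (h *\<^sub>R g) u = inner (- d - (h * \<gamma>) *\<^sub>R w - h *\<^sub>R \<xi>) u" by simp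
    then show ?thesis by (simp add: inner_diff_left)
  qed
  have g_eq: "inner g u = - inner d u / h - \<gamma> * inner w u - inner \<xi> u" for u
    using hg[of u] \<open>h > 0\<close> by (simp add: field_simps)
  have \<xi>w: "pw \<le> inner \<xi> w"
    using subdifferential_inner_ge[OF nonneg \<xi>, of 0] zero by (simp add: eff_dom_def pw_def)
  have \<xi>d: "pw - pv \<le> inner \<xi> d"
    using subdifferential_inner_ge[OF nonneg \<xi> dom] by (simp add: pw_def pv_def v_eq)
  have y_eq: "x (Suc k) + \<beta> *\<^sub>R w = (x k + \<beta> *\<^sub>R v k) + (h *\<^sub>R w + \<beta> *\<^sub>R d)"
    by (simp add: x_eq v_eq algebra_simps)
  have descent: "f (x (Suc k) + \<beta> *\<^sub>R w) \<le> f (x k + \<beta> *\<^sub>R v k) + inner g (h *\<^sub>R w + \<beta> *\<^sub>R d)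
      + L / 2 * (norm (h *\<^sub>R w + \<beta> *\<^sub>R d))\<^sup>2"
    unfolding y_eq g_def by (rule lipschitz_gradient_upper_bound[OF der lip])
  have inner_eq: "inner g (h *\<^sub>R w + \<beta> *\<^sub>R d) = - inner w d - h * \<gamma> * (norm w)\<^sup>2 - h * inner \<xi> w
      - \<beta> / h * (norm d)\<^sup>2 - \<beta> * \<gamma> * inner w d - \<beta> * inner \<xi> d"
    unfolding inner_add_right inner_scaleR_right g_eq
    using \<open>h > 0\<close> by (simp add: power2_norm_eq_inner inner_commute[of d w] algebra_simps)
  have norm_eq: "(norm (h *\<^sub>R w + \<beta> *\<^sub>R d))\<^sup>2
      = h\<^sup>2 * (norm w)\<^sup>2 + 2 * h * \<beta> * inner w d + \<beta>\<^sup>2 * (norm d)\<^sup>2"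
    unfolding power2_norm_eq_inner
    by (simp add: inner_add_left inner_add_right inner_commute[of d w] power2_eq_square algebra_simps)
  have norm_v: "(norm (v k))\<^sup>2 = (norm w)\<^sup>2 - 2 * inner w d + (norm d)\<^sup>2"
    by (simp add: v_eq power2_norm_eq_inner inner_diff_left inner_diff_right inner_commute[of d w])
  \<comment> \<open>After the kinetic terms are expanded, what remains in \<open>w\<close> and
    \<open>d\<close> is exactly minus the quadratic form of \<open>M_mat\<close>.\<close>
  have "h * pw \<le> h * inner \<xi> w" using \<xi>w \<open>h > 0\<close> by simp
  moreover have "\<beta> * (pw - pv) \<le> \<beta> * inner \<xi> d" using \<xi>d \<open>\<beta> \<ge> 0\<close> by (rule mult_left_mono)
  moreover note M_mat_quadratic_form_nonneg[OF psd, of w d] descent[unfolded inner_eq norm_eq]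
  ultimately show ?thesis
    unfolding energy_def w_def[symmetric] pw_def[symmetric] pv_def[symmetric] norm_v
    by (simp add: algebra_simps add_divide_distrib)
qed

lemma summable_norm_velocity:
  assumes "h > 0" and "\<gamma> \<ge> 0" and "\<beta> \<ge> 0"
    and "\<And>z. GDERIV f z :> gf z" and bdd: "bdd_below (range f)" and "L-lipschitz_on UNIV gf"
    and zero: "\<phi> 0 = 0" and nonneg: "\<And>z. 0 \<le> \<phi> z"
    and "r > 0" and ball: "cball 0 r \<subseteq> subdifferential \<phi> 0"
    and gen: "generated_by h \<gamma> \<beta> gf \<phi> x v"
    and "pos_semidef (M_mat h \<gamma> \<beta> L)" and "v 0 \<in> eff_dom \<phi>"
  shows "summable (\<lambda>k. norm (v k))"
proof -
  define E where "E k = energy f \<phi> \<beta> \<gamma> (x k) (v k)" for k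
  \<comment> \<open>The initial velocity is in the domain by hypothesis; each later one has a
    subgradient, which entails membership.\<close>
  have dom: "v k \<in> eff_dom \<phi>" for k
  proof (cases k)
    case (Suc n)
    then show ?thesis
      using generated_by_subgradient[OF \<open>h > 0\<close> gen, of n] by (auto simp: subdifferential_def)
  qed (simp add: assms)
  have friction: "r * norm (v k) \<le> real_of_ereal (\<phi> (v k))" for k
    using subdifferential_at_0_cball_lower_bound[OF zero _ ball, of "v k"] \<open>r > 0\<close> dom[of k]
    by (cases "\<phi> (v k)") (auto simp: eff_dom_def)
  have step: "E (Suc k) + h * r * norm (v (Suc k)) \<le> E k" for k
  proof -
    have "E (Suc k) + h * real_of_ereal (\<phi> (v (Suc k))) \<le> E k"
      unfolding E_def using assms dom by (intro energy_step) auto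
    moreover have "h * (r * norm (v (Suc k))) \<le> h * real_of_ereal (\<phi> (v (Suc k)))"
      using friction \<open>h > 0\<close> by (intro mult_left_mono) auto
    ultimately show ?thesis by simp
  qed
  have sum: "E n + h * r * (\<Sum>k<n. norm (v (Suc k))) \<le> E 0" for n
  proof (induction n)
    case (Suc n)
    with step[of n] show ?case by (simp add: algebra_simps)
  qed simp
  obtain m where m: "\<And>z. m \<le> f z" using bdd by (auto simp: bdd_below_def)
  \<comment> \<open>The kinetic and friction parts are nonnegative, so a lower bound of
    \<open>f\<close> bounds the energy.\<close>
  have "m \<le> E n" for n
    unfolding E_def energy_def using m assms nonneg
    by (intro add_increasing2) (auto intro!: mult_nonneg_nonneg real_of_ereal_pos)
  with sum have "h * r * (\<Sum>k<n. norm (v (Suc k))) \<le> E 0 - m" for n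
    by (smt (verit))
  then have "(\<Sum>k<n. norm (v (Suc k))) \<le> (E 0 - m) / (h * r)" for n
    using \<open>h > 0\<close> \<open>r > 0\<close> by (simp add: field_simps)
  then have "summable (\<lambda>k. norm (v (Suc k)))"
    by (intro summableI_nonneg_bounded) auto
  then show ?thesis by (simp only: summable_Suc_iff[of "\<lambda>k. norm (v k)"])
qed

section \<open>Limit of the positions and margins near it\<close>

text \<open>The increments of \<open>x\<close> are \<open>h *\<^sub>R v (Suc k)\<close>, hence
  absolutely summable; completeness of the space turns the Cauchy property into convergence.\<close>

lemma convergent_of_summable_velocity:
  fixes x v :: "nat \<Rightarrow> 'a::{real_inner, complete_space}"
  assumes "h > 0" and gen: "generated_by h \<gamma> \<beta> gf \<phi> x v" and "summable (\<lambda>k. norm (v k))"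
  shows "convergent x"
proof -
  have "summable (\<lambda>k. norm (h *\<^sub>R v (Suc k)))"
    using assms by (simp add: summable_mult summable_Suc_iff[of "\<lambda>k. norm (v k)"])
  moreover have diff: "h *\<^sub>R v (Suc k) = x (Suc k) - x k" for k
  proof -
    have "(x (Suc k) - x k) /\<^sub>R h = v (Suc k)" using gen by (simp add: generated_by_def)
    with \<open>h > 0\<close> show ?thesis by (metis less_irrefl pos_divideR_le_eq scaleR_scaleR right_inverse scaleR_one)
  qed
  ultimately have norms: "summable (\<lambda>k. norm (x (Suc k) - x k))" by simp
  have "Cauchy x"
  proof (rule metric_CauchyI)
    fix e :: real assume "e > 0"
    then obtain N where N: "\<And>m n. m \<ge> N \<Longrightarrow> norm (\<Sum>k=m..<n. norm (x (Suc k) - x k)) < e"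
      using norms[unfolded summable_Cauchy] by blast
    have "dist (x m) (x n) < e" if "N \<le> m" "m \<le> n" for m n
    proof -
      have "dist (x m) (x n) = norm (\<Sum>k=m..<n. x (Suc k) - x k)"
        using that by (simp add: sum_Suc_diff' dist_norm norm_minus_commute)
      also have "\<dots> \<le> (\<Sum>k=m..<n. norm (x (Suc k) - x k))" by (rule norm_sum)
      finally show ?thesis using N[OF that(1), of n] by simp
    qed
    then have "dist (x m) (x n) < e" if "N \<le> m" "N \<le> n" for m n
      using that by (metis dist_commute linear)
    then show "\<exists>M. \<forall>m\<ge>M. \<forall>n\<ge>M. dist (x m) (x n) < e" by blast
  qed
  then show ?thesis by (rule Cauchy_convergent)
qed

text \<open>Half the radius \<open>e\<close> of a ball around \<open>- g'\<close> is spent on the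
  distance from \<open>g k\<close> to \<open>g'\<close>; the other half remains as the uniform
  margin.\<close>

lemma eventually_stick_margin_ge:
  fixes g :: "nat \<Rightarrow> 'a::real_inner"
  assumes "g \<longlonglongrightarrow> g'" and "- g' \<in> interior (subdifferential \<phi> 0)"
  obtains \<epsilon> where "\<epsilon> > 0" and "\<forall>\<^sub>F k in sequentially. ereal \<epsilon> \<le> stick_margin \<phi> (g k)"
proof -
  obtain e where e: "e > 0" "cball (- g') e \<subseteq> subdifferential \<phi> 0"
    using assms(2) unfolding mem_interior_cball by blast
  have "\<forall>\<^sub>F k in sequentially. dist (g k) g' < e / 2"
    using assms(1) e(1) by (intro tendstoD) auto
  then have "\<forall>\<^sub>F k in sequentially. ereal (e / 2) \<le> stick_margin \<phi> (g k)"
  proof eventually_elim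
    case (elim k)
    have "cball (- g k) (e / 2) \<subseteq> cball (- g') e"
    proof
      fix u assume "u \<in> cball (- g k) (e / 2)"
      moreover have "dist (- g') u \<le> dist (- g') (- g k) + dist (- g k) u"
        by (rule dist_triangle)
      ultimately show "u \<in> cball (- g') e"
        using elim e(1) by (simp add: dist_minus dist_commute)
    qed
    with e have "ereal (e / 2) \<in> {ereal \<rho> |\<rho>. \<rho> > 0 \<and> cball (- g k) \<rho> \<subseteq> subdifferential \<phi> 0}"
      by (intro CollectI exI[of _ "e / 2"]) auto
    then show ?case unfolding stick_margin_def by (intro Sup_upper) blast
  qed
  with e(1) show ?thesis by (intro that[of "e / 2"]) auto
qed

text \<open>Limits are unique, so the existential in (c) speaks about the limit of \<open>x\<close>
  and asserts its existence as well.\<close>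

theorem theorem4p11:
  fixes f :: "'a::{real_inner, complete_space} \<Rightarrow> real"
    and gf :: "'a \<Rightarrow> 'a"
    and \<phi> :: "'a \<Rightarrow> ereal"
    and x v :: "nat \<Rightarrow> 'a"
    and h \<gamma> \<beta> L r :: real
  assumes "h > 0" and "\<gamma> \<ge> 0" and "\<beta> \<ge> 0" and "L \<ge> 0"
    and "\<And>z. GDERIV f z :> gf z"
    and "continuous_on UNIV gf"
    and "bdd_below (range f)"
    and "L-lipschitz_on UNIV gf"
    and "proper_fun \<phi>" and "lsc_fun \<phi>" and "convex_fun \<phi>"
    and "\<phi> 0 = 0" and "\<And>z. 0 \<le> \<phi> z"
    and "r > 0" and "cball 0 r \<subseteq> subdifferential \<phi> 0"
    and "generated_by h \<gamma> \<beta> gf \<phi> x v"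
  defines "y \<equiv> \<lambda>k. x k + \<beta> *\<^sub>R v k"
  defines "\<rho> \<equiv> \<lambda>k. stick_margin \<phi> (gf (y k))"
  shows
    "(\<forall>k. \<rho> k > 0 \<and> v (Suc k) \<noteq> 0 \<longrightarrow>
        ereal ((1 + h * \<gamma>) * norm (v (Suc k))) + ereal h * \<rho> k \<le> ereal (norm (v k)))
     \<and>
     (\<forall>(\<epsilon>::real) k\<^sub>0. \<epsilon> > 0 \<and> (\<forall>k\<ge>k\<^sub>0. \<rho> k \<ge> ereal \<epsilon>) \<longrightarrow>
        (\<gamma> > 0 \<longrightarrow>
          ereal_of_enat (K_stop v) - ereal (real k\<^sub>0)
            \<le> ereal (of_int \<lceil>ln (1 + \<gamma> * norm (v k\<^sub>0) / \<epsilon>) / ln (1 + h * \<gamma>)\<rceil>)) \<and>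
        (\<gamma> = 0 \<longrightarrow>
          ereal_of_enat (K_stop v) - ereal (real k\<^sub>0)
            \<le> ereal (of_int \<lceil>norm (v k\<^sub>0) / (h * \<epsilon>)\<rceil>)))
     \<and>
     (\<gamma> > 0 \<and> v 0 \<in> eff_dom \<phi> \<and> pos_semidef (M_mat h \<gamma> \<beta> L) \<longrightarrow>
        (\<exists>xlim. x \<longlonglongrightarrow> xlim \<and>
          (- gf xlim \<in> interior (subdifferential \<phi> 0) \<longrightarrow> K_stop v < \<infinity>)))"
proof (intro conjI allI impI; (elim conjE)?)
  note gen = assms(16) and zero = assms(12) and nonneg = assms(13)
  fix k
  assume "\<rho> k > 0" "v (Suc k) \<noteq> 0"
  then show "ereal ((1 + h * \<gamma>) * norm (v (Suc k))) + ereal h * \<rho> k \<le> ereal (norm (v k))"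
    unfolding \<rho>_def y_def
    using stick_margin_step[OF \<open>h > 0\<close> zero nonneg gen] by blast
next
  note gen = assms(16) and zero = assms(12) and nonneg = assms(13)
  fix \<epsilon> :: real and k0
  assume "\<epsilon> > 0" and margin: "\<forall>k\<ge>k0. ereal \<epsilon> \<le> \<rho> k"
  have stop: "K_stop v \<le> enat (k0 + N)"
    if "norm (v k0) \<le> h * \<epsilon> * (\<Sum>i<N. (1 + h * \<gamma>) ^ i)" for N
    using K_stop_le_of_margin[OF \<open>h > 0\<close> \<open>\<gamma> \<ge> 0\<close> zero nonneg gen \<open>\<epsilon> > 0\<close> _ that] margin
    by (simp add: \<rho>_def y_def)
  {
    assume "\<gamma> > 0"
    let ?q = "1 + h * \<gamma>" and ?s = "1 + \<gamma> * norm (v k0) / \<epsilon>"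
    have q: "?q > 1" and s: "?s \<ge> 1"
      using \<open>h > 0\<close> \<open>\<gamma> > 0\<close> \<open>\<epsilon> > 0\<close> by auto
    show "ereal_of_enat (K_stop v) - ereal (real k0) \<le> ereal (of_int \<lceil>ln ?s / ln ?q\<rceil>)"
    proof (rule K_stop_le_ceiling)
      show "0 \<le> ln ?s / ln ?q" using q s by simp
    next
      fix N assume "ln ?s / ln ?q \<le> real N"
      then have "ln ?s \<le> ln (?q ^ N)" using q by (simp add: field_simps ln_realpow)
      then have "?s \<le> ?q ^ N" using q s by (subst (asm) ln_le_cancel_iff) auto
      then have "\<gamma> * norm (v k0) \<le> \<epsilon> * (?q ^ N - 1)"
        using \<open>\<epsilon> > 0\<close> by (simp add: field_simps)
      \<comment> \<open>Since \<open>?q - 1 = h * \<gamma>\<close>, summing the geometric series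
        turns \<open>?s \<le> ?q ^ N\<close> into the condition of \<open>stop\<close> multiplied by
        \<open>\<gamma>\<close>.\<close>
      also have "\<dots> = \<gamma> * (h * \<epsilon> * (\<Sum>i<N. ?q ^ i))"
        using power_diff_1_eq[of ?q N] by (simp add: algebra_simps)
      finally show "K_stop v \<le> enat (k0 + N)"
        using \<open>\<gamma> > 0\<close> by (intro stop) simp
    qed
  next
    assume "\<gamma> = 0"
    show "ereal_of_enat (K_stop v) - ereal (real k0) \<le> ereal (of_int \<lceil>norm (v k0) / (h * \<epsilon>)\<rceil>)"
    proof (rule K_stop_le_ceiling)
      show "0 \<le> norm (v k0) / (h * \<epsilon>)" using \<open>h > 0\<close> \<open>\<epsilon> > 0\<close> by simp
    next
      fix N assume "norm (v k0) / (h * \<epsilon>) \<le> real N"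
      \<comment> \<open>For \<open>\<gamma> = 0\<close> the geometric sum is just
        \<open>N\<close>.\<close>
      then show "K_stop v \<le> enat (k0 + N)"
        using \<open>h > 0\<close> \<open>\<epsilon> > 0\<close> by (intro stop) (simp add: \<open>\<gamma> = 0\<close> field_simps)
    qed
  }
next
  note gen = assms(16) and zero = assms(12) and nonneg = assms(13)
  assume "\<gamma> > 0" and dom: "v 0 \<in> eff_dom \<phi>" and psd: "pos_semidef (M_mat h \<gamma> \<beta> L)"
  have summable: "summable (\<lambda>k. norm (v k))"
    using assms(5) by (rule summable_norm_velocity[OF \<open>h > 0\<close> \<open>\<gamma> \<ge> 0\<close> \<open>\<beta> \<ge> 0\<close> _ assms(7,8)
        zero nonneg \<open>r > 0\<close> assms(15) gen psd dom])
  then obtain xlim where xlim: "x \<longlonglongrightarrow> xlim"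
    using convergent_of_summable_velocity[OF \<open>h > 0\<close> gen] by (auto simp: convergent_def)
  have "K_stop v < \<infinity>" if int: "- gf xlim \<in> interior (subdifferential \<phi> 0)"
  proof -
    have "v \<longlonglongrightarrow> 0"
      using summable_LIMSEQ_zero[OF summable] by (rule tendsto_norm_zero_cancel)
    then have "(\<lambda>k. x k + \<beta> *\<^sub>R v k) \<longlonglongrightarrow> xlim + \<beta> *\<^sub>R 0"
      by (intro tendsto_intros xlim)
    then have "(\<lambda>k. gf (x k + \<beta> *\<^sub>R v k)) \<longlonglongrightarrow> gf xlim"
      using continuous_on_tendsto_compose[OF assms(6)] by simp
    then obtain \<epsilon> where "\<epsilon> > 0"
      and "\<forall>\<^sub>F k in sequentially. ereal \<epsilon> \<le> stick_margin \<phi> (gf (x k + \<beta> *\<^sub>R v k))"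
      using int by (rule eventually_stick_margin_ge)
    then obtain k0 where margin: "\<And>k. k \<ge> k0 \<Longrightarrow> ereal \<epsilon> \<le> stick_margin \<phi> (gf (x k + \<beta> *\<^sub>R v k))"
      by (auto simp: eventually_sequentially)
    \<comment> \<open>Finiteness allows a crude \<open>N\<close>: every summand of the geometric sum
      is at least \<open>1\<close>, so the undamped count suffices.\<close>
    obtain N where N: "norm (v k0) / (h * \<epsilon>) \<le> real N"
      using real_arch_simple by blast
    have "real N = (\<Sum>i<N. 1)" by simp
    also have "\<dots> \<le> (\<Sum>i<N. (1 + h * \<gamma>) ^ i)"
      using \<open>h > 0\<close> \<open>\<gamma> > 0\<close> by (intro sum_mono one_le_power) simp
    finally have "norm (v k0) / (h * \<epsilon>) \<le> (\<Sum>i<N. (1 + h * \<gamma>) ^ i)" using N by linarith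
    then have "norm (v k0) \<le> h * \<epsilon> * (\<Sum>i<N. (1 + h * \<gamma>) ^ i)"
      using \<open>h > 0\<close> \<open>\<epsilon> > 0\<close> by (simp add: pos_divide_le_eq mult.commute)
    then have "K_stop v \<le> enat (k0 + N)"
      using K_stop_le_of_margin[OF \<open>h > 0\<close> \<open>\<gamma> \<ge> 0\<close> zero nonneg gen \<open>\<epsilon> > 0\<close> margin] by blast
    then show ?thesis by (rule le_less_trans) simp
  qed
  with xlim show "\<exists>xlim. x \<longlonglongrightarrow> xlim \<and>
      (- gf xlim \<in> interior (subdifferential \<phi> 0) \<longrightarrow> K_stop v < \<infinity>)"
    by blast
qed

end
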